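(* Let $k$ be a domain, let $n\ge 2$, let $k[\mathbf{x}]=k[x_1,\ldots,x_n]$ be the polynomial ring over $k$, and let $\Gamma$ be a totally ordered additive group. Let $f$ be a stable coordinate of $k[\mathbf{x}]$, and let $S\subset k[\mathbf{x}]\setminus\{0\}$ be a subset such that $\operatorname{trans.deg}_k k[S]=n$. Then for each $\mathbf{w}\in\Gamma^n$ there exists an element $g\in S$ such that $f^{\mathbf{w}}$ is not divisible by $g$ in $k[\mathbf{x}]$.
   Context: "Domain" means commutative integral domain. A totally ordered additive group is an additive (abelian) group $\Gamma$ equipped with a total ordering such that $\alpha\le\beta$ implies $\alpha+\gamma\le\beta+\gamma$ for all $\alpha,\beta,\gamma\in\Gamma$. For $r\ge 1$, an element $f\in k[x_1,\ldots,x_r]$ is a coordinate of $k[x_1,\ldots,x_r]$ if there exist $f_2,\ldots,f_r\in k[x_1,\ldots,x_r]$ such that $k[f,f_2,\ldots,f_r]=k[x_1,\ldots,x_r]$. An element $f\in k[\mathbf{x}]=k[x_1,\ldots,x_n]$ is a stable coordinate of $k[\mathbf{x}]$ if there exists $m\ge n$ such that $f$ is a coordinate of $k[x_1,\ldots,x_m]$. For $\mathbf{w}=(w_1,\ldots,w_n)\in\Gamma^n$, write $a\cdot\mathbf{w}=a_1w_1+\cdots+a_nw_n$ for $a\in\mathbf{Z}^n$. For nonzero $f=\sum_a u_a x_1^{a_1}\cdots x_n^{a_n}\in k[\mathbf{x}]$ with $u_a\in k$, put $\operatorname{supp}(f)=\{a\mid u_a\neq 0\}$ and $\deg_{\mathbf{w}}f=\max\{a\cdot\mathbf{w}\mid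 a\in\operatorname{supp}(f)\}$; the $\mathbf{w}$-initial form $f^{\mathbf{w}}$ is the sum of the terms $u_ax_1^{a_1}\cdots x_n^{a_n}$ of $f$ with $a\in \operatorname{supp}(f)$ and $a\cdot\mathbf{w}=\deg_{\mathbf{w}}f$. $\operatorname{trans.deg}_k k[S]$ is the transcendence degree over $k$ of the $k$-subalgebra $k[S]$ of $k[\mathbf{x}]$ generated by $S$. *)

theory Defs
  imports "HOL-Library.Poly_Mapping" "HOL-Library.Extended_Nat" "HOL.Hull"
begin

text \<open>
  An element of \<open>('v, 'k) mpol\<close> is a polynomial over \<open>'k\<close> in variables indexed by \<open>'v\<close>,
  given by its finitely supported coefficient function on exponent vectors.
\<close>

type_synonym ('v, 'k) mpol = "('v \<Rightarrow>\<^sub>0 nat) \<Rightarrow>\<^sub>0 'k"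

definition const_poly :: "'k::zero \<Rightarrow> ('v, 'k) mpol" where
  "const_poly c = Poly_Mapping.single 0 c"

definition poly_vars :: "('v, 'k::zero) mpol \<Rightarrow> 'v set" where
  "poly_vars p = (\<Union>a \<in> Poly_Mapping.keys p. Poly_Mapping.keys a)"

text \<open>
  All the rings \<open>k[x\<^sub>1,\<dots>,x\<^sub>r]\<close> live inside one ring in countably many variables, so that
  \<open>k[x\<^sub>1,\<dots>,x\<^sub>n]\<close> is literally contained in \<open>k[x\<^sub>1,\<dots>,x\<^sub>m]\<close> for \<open>n \<le> m\<close>. The variable
  \<open>x\<^sub>i\<close> has index \<open>i - 1\<close>.
\<close>

definition poly_ring :: "nat \<Rightarrow> (nat, 'k::zero) mpol set" where
  "poly_ring r = {p. poly_vars p \<subseteq> {..<r}}"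

definition is_subalgebra :: "('v, 'k::comm_ring_1) mpol set \<Rightarrow> bool" where
  "is_subalgebra A \<longleftrightarrow>
     (\<forall>c. const_poly c \<in> A) \<and> (\<forall>p\<in>A. \<forall>q\<in>A. p + q \<in> A) \<and> (\<forall>p\<in>A. \<forall>q\<in>A. p * q \<in> A)"

definition gen_algebra :: "('v, 'k::comm_ring_1) mpol set \<Rightarrow> ('v, 'k) mpol set" where
  "gen_algebra S = is_subalgebra hull S"

definition coordinate :: "nat \<Rightarrow> (nat, 'k::comm_ring_1) mpol \<Rightarrow> bool" where
  "coordinate r f \<longleftrightarrow> r \<ge> 1 \<and>
     (\<exists>F. F 0 = f \<and> (\<forall>i<r. F i \<in> poly_ring r) \<and> gen_algebra (F ` {..<r}) = poly_ring r)"

definition stable_coordinate :: "nat \<Rightarrow> (nat, 'k::comm_ring_1) mpol \<Rightarrow> bool" where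
  "stable_coordinate n f \<longleftrightarrow> f \<in> poly_ring n \<and> (\<exists>m\<ge>n. coordinate m f)"

definition poly_subst ::
  "('u \<Rightarrow> ('v, 'k::comm_ring_1) mpol) \<Rightarrow> ('u, 'k) mpol \<Rightarrow> ('v, 'k) mpol" where
  "poly_subst \<phi> p =
     (\<Sum>a\<in>Poly_Mapping.keys p. const_poly (Poly_Mapping.lookup p a) * (\<Prod>u\<in>Poly_Mapping.keys a. \<phi> u ^ Poly_Mapping.lookup a u))"

text \<open>
  The polynomial relations on \<open>B\<close> use variables indexed by the elements of \<open>B\<close> themselves;
  each variable is replaced by its own index.
\<close>

definition alg_independent :: "('v, 'k::comm_ring_1) mpol set \<Rightarrow> bool" where
  "alg_independent B \<longleftrightarrow>
     (\<forall>p :: (('v, 'k) mpol, 'k) mpol. poly_vars p \<subseteq> B \<and> poly_subst (\<lambda>b. b) p = 0 \<longrightarrow> p = 0)"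

text \<open>
  As usual for an algebra \<open>A\<close> over a domain \<open>k\<close>, the transcendence degree is the largest
  size of a subset of \<open>A\<close> that is algebraically independent over \<open>k\<close>.
\<close>

definition trans_deg :: "('v, 'k::comm_ring_1) mpol set \<Rightarrow> enat" where
  "trans_deg A = Sup {enat (card B) | B. B \<subseteq> A \<and> finite B \<and> alg_independent B}"

text \<open>The inner sum is the multiple \<open>a\<^sub>i w\<^sub>i\<close> in the additive group.\<close>

definition weight :: "nat \<Rightarrow> (nat \<Rightarrow> 'g::ab_group_add) \<Rightarrow> (nat \<Rightarrow>\<^sub>0 nat) \<Rightarrow> 'g" where
  "weight n w a = (\<Sum>i<n. \<Sum>_<Poly_Mapping.lookup a i. w i)"

text \<open>Both definitions below are meant for \<open>f\<close> in \<open>poly_ring n\<close>, the degree only for \<open>f \<noteq> 0\<close>.\<close>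

definition wdegree ::
  "nat \<Rightarrow> (nat \<Rightarrow> 'g::linordered_ab_group_add) \<Rightarrow> (nat, 'k::zero) mpol \<Rightarrow> 'g" where
  "wdegree n w f = Max (weight n w ` Poly_Mapping.keys f)"

definition initial_form ::
  "nat \<Rightarrow> (nat \<Rightarrow> 'g::linordered_ab_group_add) \<Rightarrow> (nat, 'k::comm_monoid_add) mpol \<Rightarrow> (nat, 'k) mpol"
  where
  "initial_form n w f =
     (\<Sum>a\<in>{a \<in> Poly_Mapping.keys f. weight n w a = wdegree n w f}. Poly_Mapping.single a (Poly_Mapping.lookup f a))"

end

theory Submission
  imports Defs "HOL-Computational_Algebra.Polynomial" "HOL-Library.FuncSet"
begin

text \<open>The theorem rests on degenerating an action of the additive group. Write
  \<open>f = F\<^sub>0\<close> for generators \<open>F\<^sub>0, \<dots>, F\<^sub>m\<^sub>-\<^sub>1\<close> of \<open>k[x\<^sub>1,\<dots>,x\<^sub>m]\<close>. The shift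
  \<open>F\<^sub>j \<mapsto> F\<^sub>j + T\<close> for one \<open>j \<noteq> 0\<close> fixes \<open>f\<close>. It restricts to a homomorphism \<open>\<phi>\<close> from
  \<open>k[x\<^sub>1,\<dots>,x\<^sub>n]\<close> to \<open>k[x\<^sub>1,\<dots>,x\<^sub>m][T]\<close> that is the inclusion at \<open>T = 0\<close>; because \<open>n \<ge> 2\<close>,
  some \<open>j\<close> makes the restriction differ from the inclusion
  (\<open>coordinate_fixed_by_nontrivial_shift\<close>).

  Give \<open>x\<^sub>1,\<dots>,x\<^sub>n\<close> the weights \<open>w\<close>, the other variables weight zero, and \<open>T\<close> the largest weight
  for which no \<open>\<phi>(x\<^sub>i)\<close> exceeds the weight of \<open>x\<^sub>i\<close>; it exists after a common scaling of all
  weights (\<open>exists_minimal_slope\<close>). Replacing each \<open>\<phi>(x\<^sub>i)\<close> by its part of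
  that weight gives a homomorphism \<open>\<psi>\<close>, still the inclusion at \<open>T = 0\<close> and still nontrivial by
  the choice of the weight of \<open>T\<close>. Comparing the parts of top weight in \<open>\<phi>(f) = f\<close> shows that
  \<open>\<psi>\<close> fixes the initial form of \<open>f\<close> (\<open>degeneration\<close>). The homomorphism \<open>\<phi>\<close> is never
  iterated, so the target may have more variables than the source; this is what makes the
  argument work for stable coordinates.

  If \<open>g\<close> divides the initial form, then \<open>\<psi>(g)\<close> divides a nonzero polynomial of degree zero in \<open>T\<close>
  over a domain, so \<open>\<psi>(g)\<close> has degree zero in \<open>T\<close> and equals its value \<open>g\<close> at \<open>T = 0\<close>. Thus if
  all elements of \<open>S\<close> were divisors, \<open>\<psi>\<close> would fix \<open>k[S]\<close>. That is impossible in transcendence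
  degree \<open>n\<close>: every \<open>x\<^sub>i\<close> would be algebraic over fixed elements, whereas an element moved by \<open>\<psi>\<close>
  is transcendental over them (\<open>fixed_polynomials_not_full\<close>).

  The only input from dimension theory is that \<open>n + 1\<close> polynomials in \<open>n\<close> variables over a domain
  are algebraically dependent (\<open>exists_algebraic_relation\<close>). It also yields the algebraic
  independence of the \<open>F\<^sub>i\<close> and the existence of a suitable \<open>j\<close>.\<close>

abbreviation keys :: "('a \<Rightarrow>\<^sub>0 'b::zero) \<Rightarrow> 'a set" where "keys \<equiv> Poly_Mapping.keys"
abbreviation lookup :: "('a \<Rightarrow>\<^sub>0 'b::zero) \<Rightarrow> 'a \<Rightarrow> 'b" where "lookup \<equiv> Poly_Mapping.lookup"
abbreviation single :: "'a \<Rightarrow> 'b::zero \<Rightarrow> 'a \<Rightarrow>\<^sub>0 'b" where "single \<equiv> Poly_Mapping.single"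

section \<open>Evaluation homomorphisms\<close>

definition var :: "'v \<Rightarrow> ('v, 'k::zero_neq_one) mpol" where
  "var u = single (single u 1) 1"

definition mon_eval :: "('v \<Rightarrow> 'r::comm_monoid_mult) \<Rightarrow> ('v \<Rightarrow>\<^sub>0 nat) \<Rightarrow> 'r" where
  "mon_eval v a = (\<Prod>u\<in>keys a. v u ^ lookup a u)"

text \<open>The coefficient map is a parameter so that the same lemmas serve substitutions into polynomials
  and into polynomials in a further variable \<open>T\<close>.\<close>

definition eval :: "('k \<Rightarrow> 'r) \<Rightarrow> ('v \<Rightarrow> 'r) \<Rightarrow> ('v, 'k::zero) mpol \<Rightarrow> 'r::comm_ring_1" where
  "eval c v p = (\<Sum>a\<in>keys p. c (lookup p a) * mon_eval v a)"

definition part :: "'a set \<Rightarrow> ('a \<Rightarrow>\<^sub>0 'k::comm_monoid_add) \<Rightarrow> 'a \<Rightarrow>\<^sub>0 'k" where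
  "part A p = (\<Sum>a\<in>keys p \<inter> A. single a (lookup p a))"

lemma lookup_sum_single:
  assumes "finite A"
  shows "lookup (\<Sum>a\<in>A. single a (c a)) b = (if b \<in> A then c b else 0)"
  using assms by (simp add: lookup_sum lookup_single when_def)

lemma lookup_part: "lookup (part A p) a = (if a \<in> A then lookup p a else 0)"
  unfolding part_def by (auto simp: lookup_sum_single not_in_keys_iff_lookup_eq_zero)

lemma keys_part: "keys (part A p) = keys p \<inter> A"
  by (auto simp: in_keys_iff lookup_part split: if_splits)

lemma sum_monomials: "(\<Sum>a\<in>keys p. single a (lookup p a)) = p"
  by (rule poly_mapping_eqI) (auto simp: lookup_sum_single not_in_keys_iff_lookup_eq_zero)

lemma poly_subst_eq_eval: "poly_subst v = eval const_poly v"
  by (simp add: fun_eq_iff poly_subst_def eval_def mon_eval_def)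

lemma const_poly_simps:
  "const_poly (0::'k::comm_ring_1) = (0 :: ('v, 'k) mpol)" "const_poly (1::'k) = (1 :: ('v, 'k) mpol)"
  "const_poly (r + s) = (const_poly r + const_poly s :: ('v, 'k) mpol)"
  "const_poly (r * s) = (const_poly r * const_poly s :: ('v, 'k) mpol)"
  by (simp_all add: const_poly_def single_add mult_single)

lemma mon_eval_superset:
  assumes "finite U" "keys a \<subseteq> U"
  shows "mon_eval v a = (\<Prod>u\<in>U. v u ^ lookup a u)"
  unfolding mon_eval_def using assms
  by (intro prod.mono_neutral_left) (auto simp: not_in_keys_iff_lookup_eq_zero)

lemma mon_eval_add: "mon_eval v (a + b) = mon_eval v a * mon_eval v b"
proof -
  let ?U = "keys a \<union> keys b"
  have "mon_eval v (a + b) = (\<Prod>u\<in>?U. v u ^ lookup (a + b) u)"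
    by (rule mon_eval_superset) (simp_all add: keys_add)
  also have "\<dots> = (\<Prod>u\<in>?U. v u ^ lookup a u) * (\<Prod>u\<in>?U. v u ^ lookup b u)"
    by (simp add: lookup_add power_add prod.distrib)
  also have "\<dots> = mon_eval v a * mon_eval v b"
    by (simp add: mon_eval_superset[of ?U])
  finally show ?thesis .
qed

lemma mon_eval_zero [simp]: "mon_eval v 0 = 1"
  by (simp add: mon_eval_def)

lemma mon_eval_single [simp]: "mon_eval v (single u e) = v u ^ e"
  by (cases "e = 0") (simp_all add: mon_eval_def)

locale coeff_hom =
  fixes c :: "'k::comm_ring_1 \<Rightarrow> 'r::comm_ring_1"
  assumes zero [simp]: "c 0 = 0" and one [simp]: "c 1 = 1"
    and add: "c (r + s) = c r + c s" and mult: "c (r * s) = c r * c s"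
begin

lemma eval_superset:
  assumes "finite A" "keys p \<subseteq> A"
  shows "eval c v p = (\<Sum>a\<in>A. c (lookup p a) * mon_eval v a)"
  unfolding eval_def using assms
  by (intro sum.mono_neutral_left) (auto simp: not_in_keys_iff_lookup_eq_zero)

lemma eval_zero [simp]: "eval c v 0 = 0"
  by (simp add: eval_def)

lemma eval_single: "eval c v (single a r) = c r * mon_eval v a"
  by (cases "r = 0") (simp_all add: eval_def)

lemma eval_const [simp]: "eval c v (const_poly r) = c r"
  by (simp add: const_poly_def eval_single)

lemma eval_one [simp]: "eval c v 1 = 1"
  by (simp add: eval_single flip: single_one)

lemma eval_var [simp]: "eval c v (var u) = v u"
  by (simp add: var_def eval_single)

lemma eval_add: "eval c v (p + q) = eval c v p + eval c v q"
proof -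
  let ?A = "keys p \<union> keys q"
  have "eval c v (p + q) = (\<Sum>a\<in>?A. c (lookup (p + q) a) * mon_eval v a)"
    by (rule eval_superset) (simp_all add: keys_add)
  also have "\<dots> = (\<Sum>a\<in>?A. c (lookup p a) * mon_eval v a) + (\<Sum>a\<in>?A. c (lookup q a) * mon_eval v a)"
    by (simp add: lookup_add add sum.distrib algebra_simps)
  also have "\<dots> = eval c v p + eval c v q"
    by (simp add: eval_superset[of ?A])
  finally show ?thesis .
qed

lemma eval_sum: "eval c v (\<Sum>i\<in>I. p i) = (\<Sum>i\<in>I. eval c v (p i))"
  by (induction I rule: infinite_finite_induct) (simp_all add: eval_add)

lemma eval_uminus: "eval c v (- p) = - eval c v p"
  using eval_add[of v p "- p"] by (simp add: eq_neg_iff_add_eq_0 add.commute)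

lemma eval_diff: "eval c v (p - q) = eval c v p - eval c v q"
  using eval_add[of v p "- q"] by (simp add: eval_uminus)

lemma eval_mult: "eval c v (p * q) = eval c v p * eval c v q"
proof -
  have "p * q = (\<Sum>a\<in>keys p. \<Sum>b\<in>keys q. single (a + b) (lookup p a * lookup q b))"
    using arg_cong2[OF sum_monomials[of p] sum_monomials[of q], of "(*)", symmetric]
    by (simp add: sum_product mult_single)
  then have "eval c v (p * q)
      = (\<Sum>a\<in>keys p. \<Sum>b\<in>keys q. (c (lookup p a) * mon_eval v a) * (c (lookup q b) * mon_eval v b))"
    by (simp add: eval_sum eval_single mult mon_eval_add mult_ac)
  also have "\<dots> = eval c v p * eval c v q"
    by (simp add: eval_def sum_product)
  finally show ?thesis .
qed

lemma eval_power: "eval c v (p ^ e) = eval c v p ^ e"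
  by (induction e) (simp_all add: eval_mult)

lemma eval_cong:
  assumes "\<And>u. u \<in> poly_vars p \<Longrightarrow> v u = v' u"
  shows "eval c v p = eval c v' p"
  unfolding eval_def mon_eval_def
  by (intro sum.cong prod.cong refl arg_cong2[where f = "(*)"] arg_cong2[where f = "(^)"] assms)
    (auto simp: poly_vars_def)

text \<open>A ring homomorphism after an evaluation is again an evaluation; applied to two
  homomorphisms, this reduces every identity between them to the variables.\<close>

lemma hom_eval:
  assumes "h 0 = 0" "h 1 = 1" "\<And>x y. h (x + y) = h x + h y" "\<And>x y. h (x * y) = h x * h y"
  shows "h (eval c v p) = eval (\<lambda>r. h (c r)) (\<lambda>u. h (v u)) p"
proof -
  have sum: "h (\<Sum>i\<in>I. g i) = (\<Sum>i\<in>I. h (g i))" for g :: "('v \<Rightarrow>\<^sub>0 nat) \<Rightarrow> 'r" and I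
    by (induction I rule: infinite_finite_induct) (simp_all add: assms)
  have pow: "h (x ^ e) = h x ^ e" for x and e :: nat
    by (induction e) (simp_all add: assms)
  have prod: "h (\<Prod>i\<in>I. g i) = (\<Prod>i\<in>I. h (g i))" for g :: "'v \<Rightarrow> 'r" and I
    by (induction I rule: infinite_finite_induct) (simp_all add: assms)
  show ?thesis
    by (simp add: eval_def mon_eval_def sum prod pow assms)
qed

end

interpretation const: coeff_hom "const_poly :: 'k::comm_ring_1 \<Rightarrow> ('v, 'k) mpol"
  by unfold_locales (simp_all add: const_poly_simps)

interpretation const_T: coeff_hom "\<lambda>r::'k::comm_ring_1. [:const_poly r :: ('v, 'k) mpol:]"
  by unfold_locales (simp_all add: const_poly_simps one_pCons mult.commute)

lemma eval_var_self: "eval const_poly var p = (p :: ('v, 'k::comm_ring_1) mpol)"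
proof -
  have "mon_eval var a = single a (1::'k)" for a :: "'v \<Rightarrow>\<^sub>0 nat"
  proof -
    have pow: "var u ^ e = single (single u e) (1::'k)" for u :: 'v and e
      by (induction e) (simp_all add: var_def mult_single flip: single_add)
    have "(\<Prod>u\<in>U. single (single u (e u)) 1) = single (\<Sum>u\<in>U. single u (e u)) (1::'k)"
      if "finite U" for U :: "'v set" and e :: "'v \<Rightarrow> nat"
      using that by induction (simp_all add: mult_single)
    then show ?thesis
      by (simp add: mon_eval_def pow sum_monomials)
  qed
  then show ?thesis
    by (simp add: eval_def const_poly_def mult_single sum_monomials)
qed

lemma eval_fixes:
  assumes "\<And>u. u \<in> poly_vars p \<Longrightarrow> v u = var u"
  shows "eval const_poly v p = p"
  using const.eval_cong[of p v var] assms by (simp add: eval_var_self)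

section \<open>Subalgebras\<close>

lemma subalgebra_closed:
  assumes "is_subalgebra A"
  shows "finite I \<Longrightarrow> (\<And>i. i \<in> I \<Longrightarrow> p i \<in> A) \<Longrightarrow> (\<Sum>i\<in>I. p i) \<in> A"
    and "finite J \<Longrightarrow> (\<And>i. i \<in> J \<Longrightarrow> q i \<in> A) \<Longrightarrow> (\<Prod>i\<in>J. q i) \<in> A"
    and "x \<in> A \<Longrightarrow> x ^ e \<in> A"
proof -
  have A: "0 \<in> A" "1 \<in> A" "\<And>p q. p \<in> A \<Longrightarrow> q \<in> A \<Longrightarrow> p + q \<in> A" "\<And>p q. p \<in> A \<Longrightarrow> q \<in> A \<Longrightarrow> p * q \<in> A"
    using assms unfolding is_subalgebra_def by (metis const_poly_simps(1), metis const_poly_simps(2), blast+)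
  show "finite I \<Longrightarrow> (\<And>i. i \<in> I \<Longrightarrow> p i \<in> A) \<Longrightarrow> (\<Sum>i\<in>I. p i) \<in> A"
    by (induction I rule: finite_induct) (auto simp: A)
  show "finite J \<Longrightarrow> (\<And>i. i \<in> J \<Longrightarrow> q i \<in> A) \<Longrightarrow> (\<Prod>i\<in>J. q i) \<in> A"
    by (induction J rule: finite_induct) (auto simp: A)
  show "x \<in> A \<Longrightarrow> x ^ e \<in> A"
    by (induction e) (auto simp: A)
qed

lemma eval_in_subalgebra:
  assumes "is_subalgebra A" "\<And>u. u \<in> poly_vars p \<Longrightarrow> v u \<in> A"
  shows "eval const_poly v p \<in> A"
  unfolding eval_def mon_eval_def
proof (rule subalgebra_closed(1)[OF assms(1)])
  fix a assume a: "a \<in> keys p"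
  have "(\<Prod>u\<in>keys a. v u ^ lookup a u) \<in> A"
    using a by (intro subalgebra_closed(2,3)[OF assms(1)] assms(2)) (auto simp: poly_vars_def)
  then show "const_poly (lookup p a) * (\<Prod>u\<in>keys a. v u ^ lookup a u) \<in> A"
    using assms(1) by (simp add: is_subalgebra_def)
qed simp

lemma subalgebra_poly_vars: "is_subalgebra {p :: ('v, 'k::comm_ring_1) mpol. poly_vars p \<subseteq> X}"
proof -
  have "poly_vars (p * q) \<subseteq> X" if p: "poly_vars p \<subseteq> X" and q: "poly_vars q \<subseteq> X" for p q :: "('v, 'k) mpol"
  proof -
    have "i \<in> X" if "a \<in> keys (p * q)" "i \<in> keys a" for a i
    proof -
      obtain b c where "a = b + c" "b \<in> keys p" "c \<in> keys q"
        using keys_mult[of p q] \<open>a \<in> keys (p * q)\<close> by blast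
      moreover from this have "i \<in> keys b \<union> keys c"
        using keys_add[of b c] \<open>i \<in> keys a\<close> by blast
      ultimately show ?thesis
        using p q unfolding poly_vars_def by blast
    qed
    then show ?thesis
      by (auto simp: poly_vars_def)
  qed
  moreover have "poly_vars (p + q) \<subseteq> X" if "poly_vars p \<subseteq> X" "poly_vars q \<subseteq> X" for p q :: "('v, 'k) mpol"
    using that keys_add[of p q] unfolding poly_vars_def by blast
  ultimately show ?thesis
    by (auto simp: is_subalgebra_def poly_vars_def const_poly_def split: if_splits)
qed

lemma subalgebra_poly_ring: "is_subalgebra (poly_ring n :: (nat, 'k::comm_ring_1) mpol set)"
  unfolding poly_ring_def by (rule subalgebra_poly_vars)

lemma var_in_poly_ring: "i < n \<Longrightarrow> (var i :: (nat, 'k::comm_ring_1) mpol) \<in> poly_ring n"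
  by (simp add: poly_ring_def poly_vars_def var_def)

lemma gen_algebra_least:
  "is_subalgebra A \<Longrightarrow> S \<subseteq> A \<Longrightarrow> gen_algebra S \<subseteq> A"
  unfolding gen_algebra_def by (rule hull_minimal)

text \<open>The polynomial expressions in the generators already form a subalgebra.\<close>

lemma gen_algebra_eq_eval:
  fixes F :: "nat \<Rightarrow> ('v, 'k::comm_ring_1) mpol"
  assumes "p \<in> gen_algebra (F ` {..<m})"
  shows "\<exists>P\<in>poly_ring m. p = eval const_poly F P"
proof -
  let ?A = "eval const_poly F ` poly_ring m"
  have "is_subalgebra ?A"
    unfolding is_subalgebra_def
  proof (intro conjI ballI allI)
    show "const_poly r \<in> ?A" for r
      using subalgebra_poly_ring[of m] unfolding is_subalgebra_def
      by (intro image_eqI[of _ _ "const_poly r"]) auto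
    show "x + y \<in> ?A" "x * y \<in> ?A" if "x \<in> ?A" "y \<in> ?A" for x y
      using that subalgebra_poly_ring[of m] unfolding is_subalgebra_def
      by (auto simp flip: const.eval_add const.eval_mult)
  qed
  moreover have "F ` {..<m} \<subseteq> ?A"
  proof
    fix x assume "x \<in> F ` {..<m}"
    then obtain i where "i < m" "x = F i" by auto
    then show "x \<in> ?A"
      by (intro image_eqI[of _ _ "var i"]) (simp_all add: var_in_poly_ring)
  qed
  ultimately show ?thesis
    using gen_algebra_least assms by blast
qed

section \<open>Algebraic relations by counting\<close>

text \<open>Elimination without division: clearing the pivot column multiplies by the pivot, which is
  harmless over a domain.\<close>

lemma exists_linear_relation:
  fixes A :: "'j \<Rightarrow> 'i \<Rightarrow> 'k::idom"
  assumes "finite J" "finite I" "card J < card I"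
  shows "\<exists>c. (\<exists>i\<in>I. c i \<noteq> 0) \<and> (\<forall>j\<in>J. (\<Sum>i\<in>I. A j i * c i) = 0)"
  using assms
proof (induction J arbitrary: A I rule: finite_induct)
  case empty
  then have "I \<noteq> {}" by auto
  then show ?case by (intro exI[of _ "\<lambda>_. 1"]) auto
next
  case (insert j J)
  show ?case
  proof (cases "\<forall>i\<in>I. A j i = 0")
    case True
    with insert show ?thesis by simp
  next
    case False
    then obtain i0 where i0: "i0 \<in> I" "A j i0 \<noteq> 0" by blast
    let ?I = "I - {i0}"
    define A' where "A' j' i = A j i0 * A j' i - A j i * A j' i0" for j' i
    have "card J < card ?I"
      using insert i0 by simp
    then obtain c where c: "\<exists>i\<in>?I. c i \<noteq> 0" "\<forall>j'\<in>J. (\<Sum>i\<in>?I. A' j' i * c i) = 0"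
      using insert.IH[of ?I A'] insert.prems by auto
    define c' where "c' i = (if i = i0 then - (\<Sum>i\<in>?I. A j i * c i) else A j i0 * c i)" for i
    have split: "(\<Sum>i\<in>I. A j' i * c' i)
        = (\<Sum>i\<in>?I. A j' i * (A j i0 * c i)) - A j' i0 * (\<Sum>i\<in>?I. A j i * c i)" for j'
      using i0 insert.prems by (subst sum.remove[of _ i0]) (simp_all add: c'_def)
    have "(\<Sum>i\<in>I. A j i * c' i) = 0"
      unfolding split by (simp add: sum_distrib_left mult_ac)
    moreover have "(\<Sum>i\<in>I. A j' i * c' i) = 0" if "j' \<in> J" for j'
      unfolding split using c(2) that by (simp add: A'_def sum_distrib_left algebra_simps sum_subtractf)
    moreover have "\<exists>i\<in>I. c' i \<noteq> 0"
      using c(1) i0 by (auto simp: c'_def)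
    ultimately show ?thesis by (intro exI[of _ c']) auto
  qed
qed

definition box :: "nat \<Rightarrow> nat \<Rightarrow> (nat \<Rightarrow>\<^sub>0 nat) set" where
  "box n K = {a. keys a \<subseteq> {..<n} \<and> (\<forall>i. lookup a i \<le> K)}"

lemma card_box: "finite (box n K)" "card (box n K) = (K + 1) ^ n"
proof -
  let ?E = "PiE {..<n} (\<lambda>_. {..K})"
  let ?h = "\<lambda>f. \<Sum>i<n. single i (f i)"
  have look: "lookup (?h f) i = (if i < n then f i else 0)" for f :: "nat \<Rightarrow> nat" and i
    by (simp add: lookup_sum_single)
  have "bij_betw ?h ?E (box n K)"
    unfolding bij_betw_def
  proof
    show "inj_on ?h ?E"
    proof (rule inj_onI)
      fix f g assume "f \<in> ?E" "g \<in> ?E" "?h f = ?h g"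
      then have "f i = g i" if "i \<in> {..<n}" for i
        using that look[of f i] look[of g i] by simp
      then show "f = g"
        using \<open>f \<in> ?E\<close> \<open>g \<in> ?E\<close> by (intro PiE_ext)
    qed
    have "a \<in> ?h ` ?E" if "a \<in> box n K" for a
    proof (rule image_eqI)
      show "a = ?h (FuncSet.restrict (lookup a) {..<n})"
        using that by (intro poly_mapping_eqI) (auto simp: look box_def in_keys_iff)
      show "FuncSet.restrict (lookup a) {..<n} \<in> ?E"
        using that by (auto simp: box_def)
    qed
    moreover have "?h f \<in> box n K" if "f \<in> ?E" for f
      using that by (auto simp: box_def look in_keys_iff PiE_iff split: if_splits)
    ultimately show "?h ` ?E = box n K" by blast
  qed
  moreover have "finite ?E" "card ?E = (K + 1) ^ n"
    by (simp_all add: finite_PiE card_PiE)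
  ultimately show "finite (box n K)" "card (box n K) = (K + 1) ^ n"
    by (auto simp: bij_betw_finite bij_betw_same_card)
qed

lemma box_mono: "K \<le> L \<Longrightarrow> box n K \<subseteq> box n L"
  by (auto simp: box_def intro: order_trans)

lemma keys_mult_box:
  assumes "keys p \<subseteq> box n K" "keys q \<subseteq> box n L"
  shows "keys (p * q) \<subseteq> box n (K + L)"
proof
  fix a assume "a \<in> keys (p * q)"
  then obtain b c where "a = b + c" "b \<in> keys p" "c \<in> keys q"
    using keys_mult by blast
  then show "a \<in> box n (K + L)"
    using assms keys_add[of b c] by (fastforce simp: box_def lookup_add intro: add_mono)
qed

lemma keys_power_box:
  assumes "keys (p :: (nat, 'k::comm_ring_1) mpol) \<subseteq> box n K"
  shows "keys (p ^ e) \<subseteq> box n (e * K)"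
proof (induction e)
  case (Suc e)
  then show ?case using keys_mult_box[OF assms Suc] by simp
qed (auto simp: box_def)

lemma keys_prod_box:
  assumes "\<And>i. i \<in> U \<Longrightarrow> keys (p i :: (nat, 'k::comm_ring_1) mpol) \<subseteq> box n (K i)"
  shows "keys (\<Prod>i\<in>U. p i) \<subseteq> box n (\<Sum>i\<in>U. K i)"
  using assms
proof (induction U rule: infinite_finite_induct)
  case (insert i U)
  then show ?case using keys_mult_box[of "p i" n "K i"] by simp
qed (auto simp: box_def)

lemma poly_ring_bounded:
  assumes "finite X" "X \<subseteq> poly_ring n"
  shows "\<exists>D\<ge>1. \<forall>p\<in>X. keys p \<subseteq> box n D"
  using assms
proof (induction rule: finite_induct)
  case (insert p X)
  then obtain D where D: "D \<ge> 1" "\<forall>p\<in>X. keys p \<subseteq> box n D" by auto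
  define E where "E = Max (insert D ((\<lambda>(a, i). lookup a i) ` Sigma (keys p) keys))"
  have fin: "finite (insert D ((\<lambda>(a, i). lookup a i) ` Sigma (keys p) keys))"
    by simp
  have "D \<le> E" unfolding E_def by (rule Max_ge[OF fin]) simp
  have "lookup a i \<le> E" if "a \<in> keys p" for a i
  proof (cases "i \<in> keys a")
    case True
    with that show ?thesis unfolding E_def by (intro Max_ge[OF fin]) force
  qed (simp add: not_in_keys_iff_lookup_eq_zero)
  then have "keys p \<subseteq> box n E"
    using insert.prems by (auto simp: box_def poly_ring_def poly_vars_def)
  then show ?case
    using D \<open>D \<le> E\<close> box_mono[of D E n] by (intro exI[of _ E]) auto
qed auto

text \<open>The monomials in \<open>b\<^sub>0,\<dots>,b\<^sub>n\<^sub>-\<^sub>1,u\<close> with all exponents at most \<open>d\<close> number \<open>(d + 1)\<^sup>n\<^sup>+\<^sup>1\<close>, but they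
  involve only monomials in \<open>n\<close> variables with exponents bounded by a multiple of \<open>d\<close>, whose
  number grows like \<open>d\<^sup>n\<close>. For large \<open>d\<close> they are linearly dependent. The relation is recorded by
  the powers of \<open>u\<close>, the form in which it can be compared with a polynomial in \<open>T\<close>.\<close>

lemma exists_algebraic_relation:
  fixes b :: "nat \<Rightarrow> (nat, 'k::idom) mpol"
  assumes b: "\<And>i. i < n \<Longrightarrow> b i \<in> poly_ring n" and u: "u \<in> poly_ring n"
  shows "\<exists>q d. (\<exists>j\<le>d. q j \<noteq> 0) \<and> (\<forall>j. q j \<in> poly_ring n) \<and>
    (\<Sum>j\<le>d. eval const_poly b (q j) * u ^ j) = 0"
proof -
  obtain D where D: "D \<ge> 1" "\<forall>p \<in> insert u (b ` {..<n}). keys p \<subseteq> box n D"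
    using poly_ring_bounded[of "insert u (b ` {..<n})" n] b u by auto
  \<comment> \<open>Exponents up to \<open>d\<close> in \<open>n + 1\<close> polynomials with exponents up to \<open>D\<close> give exponents up to
    \<open>D (n + 1) d\<close>; with this \<open>d\<close>, there are at most \<open>d (d + 1)\<^sup>n\<close> equations.\<close>
  define d where "d = (D * (n + 1)) ^ n"
  let ?I = "box n d \<times> {..d}"
  let ?J = "box n (D * (n + 1) * d)"
  define m where "m = (\<lambda>(a, j). mon_eval b a * u ^ j)"
  have "keys (m (a, j)) \<subseteq> ?J" if "a \<in> box n d" "j \<le> d" for a j
  proof -
    have "keys (mon_eval b a) \<subseteq> box n (\<Sum>i<n. lookup a i * D)"
    proof -
      have "mon_eval b a = (\<Prod>i<n. b i ^ lookup a i)"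
        using that by (intro mon_eval_superset) (auto simp: box_def)
      then show ?thesis
        using D by (auto intro!: keys_prod_box keys_power_box)
    qed
    moreover have "keys (u ^ j) \<subseteq> box n (j * D)"
      using D by (intro keys_power_box) simp
    ultimately have "keys (m (a, j)) \<subseteq> box n ((\<Sum>i<n. lookup a i * D) + j * D)"
      unfolding m_def prod.case by (rule keys_mult_box)
    also have "(\<Sum>i<n. lookup a i * D) + j * D \<le> (\<Sum>i<n. d * D) + d * D"
      using that by (intro add_mono sum_mono mult_right_mono) (auto simp: box_def)
    then have "box n ((\<Sum>i<n. lookup a i * D) + j * D) \<subseteq> ?J"
      by (intro box_mono) (simp add: algebra_simps)
    finally show ?thesis .
  qed
  then have m_keys: "keys (m i) \<subseteq> ?J" if "i \<in> ?I" for i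
    using that by auto
  have "card ?J < card ?I"
  proof -
    have "card ?J \<le> (D * (n + 1) * (d + 1)) ^ n"
      unfolding card_box using D by (intro power_mono) (simp_all add: distrib_left)
    also have "\<dots> = d * (d + 1) ^ n"
      unfolding power_mult_distrib[of "D * (n + 1)"] by (simp only: flip: d_def)
    also have "\<dots> < card ?I"
      unfolding card_cartesian_product card_box by simp
    finally show ?thesis .
  qed
  then obtain c where c: "\<exists>i\<in>?I. c i \<noteq> 0" "\<forall>e\<in>?J. (\<Sum>i\<in>?I. lookup (m i) e * c i) = 0"
    using exists_linear_relation[of ?J ?I "\<lambda>e i. lookup (m i) e"] by (auto simp: card_box)
  define q where "q j = (\<Sum>a\<in>box n d. single a (c (a, j)))" for j
  have look: "lookup (q j) a = (if a \<in> box n d then c (a, j) else 0)" for j a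
    by (simp add: q_def lookup_sum_single card_box)
  have q_keys: "keys (q j) \<subseteq> box n d" for j
    by (auto simp: in_keys_iff look split: if_splits)
  have "\<exists>j\<le>d. q j \<noteq> 0"
    using c(1) look by (auto split: if_splits) (metis lookup_zero)
  moreover have "q j \<in> poly_ring n" for j
    using q_keys[of j] by (fastforce simp: poly_ring_def poly_vars_def box_def)
  moreover have "(\<Sum>j\<le>d. eval const_poly b (q j) * u ^ j) = 0"
  proof -
    have "(\<Sum>j\<le>d. eval const_poly b (q j) * u ^ j)
        = (\<Sum>j\<le>d. \<Sum>a\<in>box n d. const_poly (c (a, j)) * m (a, j))"
      by (simp add: const.eval_superset[OF card_box(1) q_keys] look m_def sum_distrib_left mult_ac)
    also have "\<dots> = (\<Sum>i\<in>?I. const_poly (c i) * m i)"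
      by (subst sum.swap) (simp add: sum.cartesian_product case_prod_unfold)
    also have "\<dots> = 0"
    proof (rule poly_mapping_eqI)
      fix e
      have const_mult: "lookup (const_poly r * p) e = r * lookup p e" for r :: 'k and p :: "(nat, 'k) mpol"
        by (simp add: const_poly_def flip: mult_map_scale_conv_mult) (simp add: Poly_Mapping.map.rep_eq when_def)
      show "lookup (\<Sum>i\<in>?I. const_poly (c i) * m i) e = lookup 0 e"
      proof (cases "e \<in> ?J")
        case True
        with c(2) show ?thesis by (simp add: lookup_sum const_mult) (simp add: mult.commute)
      next
        case False
        have "lookup (m i) e = 0" if "i \<in> ?I" for i
          using m_keys[OF that] False by (auto simp: in_keys_iff)
        then show ?thesis by (simp add: lookup_sum const_mult)
      qed
    qed
    finally show ?thesis .
  qed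
  ultimately show ?thesis by blast
qed

text \<open>The sum is the composition of \<open>\<Sum>\<^sub>j c\<^sub>j T\<^sup>j\<close> with \<open>U\<close>, and composition with a nonconstant
  polynomial over a domain is injective.\<close>

lemma nonconstant_is_transcendental:
  fixes U :: "'a::idom poly"
  assumes "degree U > 0" "(\<Sum>j\<le>d. [:c j:] * U ^ j) = 0" "j \<le> d"
  shows "c j = 0"
proof -
  let ?C = "\<Sum>j\<le>d. monom (c j) j"
  have "pcompose (monom r j) U = [:r:] * U ^ j" for r j
    by (induction j) (simp_all add: monom_Suc monom_0 pcompose_pCons)
  then have "pcompose ?C U = 0"
    using assms(2) by (simp add: pcompose_sum)
  then have "?C = 0"
    using pcompose_eq_0 assms(1) by blast
  then have "coeff ?C j = 0" by simp
  then show ?thesis using assms(3) by (simp add: coeff_sum)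
qed

section \<open>Generators of a polynomial ring\<close>

lemma eval_inverse:
  fixes F G :: "nat \<Rightarrow> (nat, 'k::comm_ring_1) mpol"
  assumes "\<And>i. i < m \<Longrightarrow> eval const_poly F (G i) = var i" "P \<in> poly_ring m"
  shows "eval const_poly F (eval const_poly G P) = P"
proof -
  have "eval const_poly F (eval const_poly G P) = eval const_poly (\<lambda>i. eval const_poly F (G i)) P"
    by (subst const.hom_eval) (simp_all add: const.eval_add const.eval_mult)
  also have "\<dots> = P"
    using assms by (intro eval_fixes) (auto simp: poly_ring_def)
  finally show ?thesis .
qed

text \<open>Suppose \<open>P \<noteq> 0\<close>.
  The \<open>m + 1\<close> polynomials \<open>G\<^sub>0,\<dots>,G\<^sub>m\<^sub>-\<^sub>1,P\<close> satisfy an algebraic relation, and after cancelling a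
  power of \<open>P\<close> its part \<open>q\<close> free of \<open>P\<close> is nonzero. Substituting \<open>F\<close> kills \<open>P\<close> and turns each
  \<open>G\<^sub>i\<close> into \<open>x\<^sub>i\<close>, so \<open>q = 0\<close>, a contradiction.
  This is the fact that a surjective endomorphism of a polynomial ring is injective.\<close>

lemma generators_independent:
  fixes F G :: "nat \<Rightarrow> (nat, 'k::idom) mpol"
  assumes G: "\<And>i. i < m \<Longrightarrow> G i \<in> poly_ring m" "\<And>i. i < m \<Longrightarrow> eval const_poly F (G i) = var i"
    and P: "P \<in> poly_ring m" "eval const_poly F P = 0"
  shows "P = 0"
proof (rule ccontr)
  assume "P \<noteq> 0"
  obtain q d where q: "\<exists>j\<le>d. q j \<noteq> 0" "\<forall>j. q j \<in> poly_ring m"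
      "(\<Sum>j\<le>d. eval const_poly G (q j) * P ^ j) = 0"
    using exists_algebraic_relation[of m G P] G(1) P(1) by blast
  define k where "k = (LEAST j. q j \<noteq> 0)"
  obtain j where j: "j \<le> d" "q j \<noteq> 0" using q(1) by blast
  have k: "q k \<noteq> 0" unfolding k_def by (rule LeastI[of "\<lambda>j. q j \<noteq> 0", OF j(2)])
  have "k \<le> j" unfolding k_def by (rule Least_le[of "\<lambda>j. q j \<noteq> 0", OF j(2)])
  with j(1) have "k \<le> d" by simp
  have below: "q j = 0" if "j < k" for j
    using not_less_Least[of j "\<lambda>j. q j \<noteq> 0"] that unfolding k_def by blast
  let ?r = "\<Sum>i\<le>d - k. eval const_poly G (q (k + i)) * P ^ i"
  have "(\<Sum>j\<le>d. eval const_poly G (q j) * P ^ j) = (\<Sum>j\<in>{k..d}. eval const_poly G (q j) * P ^ j)"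
    by (rule sum.mono_neutral_right) (auto simp: below)
  also have "\<dots> = (\<Sum>i\<le>d - k. eval const_poly G (q (k + i)) * P ^ (k + i))"
    using \<open>k \<le> d\<close> by (intro sum.reindex_bij_witness[of _ "\<lambda>i. k + i" "\<lambda>j. j - k"]) auto
  also have "\<dots> = P ^ k * ?r"
    by (simp add: sum_distrib_left power_add mult_ac)
  finally have "?r = 0"
    using q(3) \<open>P \<noteq> 0\<close> by simp
  then have "0 = eval const_poly F ?r"
    by simp
  also have "\<dots> = (\<Sum>i\<le>d - k. q (k + i) * 0 ^ i)"
    using q(2) P(2) by (simp add: const.eval_sum const.eval_mult const.eval_power eval_inverse[OF G(2)])
  also have "\<dots> = q k"
    by (subst sum.remove[of _ 0]) (auto intro!: sum.neutral)
  finally show False using k by simp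
qed

text \<open>Two polynomials in one variable are algebraically dependent, and a relation between \<open>G\<^sub>0\<close> and
  \<open>G\<^sub>1\<close> becomes one between two variables. Hence a ring with two
  variables is not contained in the subalgebra of one polynomial, which is the essential use of
  \<open>n \<ge> 2\<close>.\<close>

lemma no_two_variables_in_one_generator:
  fixes F G :: "nat \<Rightarrow> (nat, 'k::idom) mpol"
  assumes "G 0 \<in> poly_ring 1" "G 1 \<in> poly_ring 1"
  shows "\<not> (eval const_poly F (G 0) = var 0 \<and> eval const_poly F (G 1) = var 1)"
proof
  assume F: "eval const_poly F (G 0) = var 0 \<and> eval const_poly F (G 1) = var 1"
  obtain q d where q: "\<exists>j\<le>d. q j \<noteq> 0" "\<forall>j. q j \<in> poly_ring 1"
      "(\<Sum>j\<le>d. eval const_poly G (q j) * G 1 ^ j) = 0"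
    using exists_algebraic_relation[of 1 G "G 1"] assms by auto
  let ?h = "eval (\<lambda>r. [:const_poly r:]) (\<lambda>i. if i = 0 then [:var 0:] else [:0, 1:])
    :: (nat, 'k) mpol \<Rightarrow> (nat, 'k) mpol poly"
  have h: "?h p = [:p:]" if "p \<in> poly_ring 1" for p
  proof -
    have "[:p:] = [:eval const_poly var p:]"
      by (simp add: eval_var_self)
    also have "\<dots> = eval (\<lambda>r. [:const_poly r:]) (\<lambda>i. [:var i:]) p"
      by (subst const.hom_eval[where h = "\<lambda>x. [:x:]"]) (simp_all add: one_pCons mult.commute)
    also have "\<dots> = ?h p"
      using that by (intro const_T.eval_cong) (auto simp: poly_ring_def)
    finally show ?thesis by simp
  qed
  have inv: "eval const_poly F (eval const_poly G (q j)) = q j" for j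
    using q(2) F by (intro eval_inverse[of 1]) auto
  have "0 = ?h (eval const_poly F (\<Sum>j\<le>d. eval const_poly G (q j) * G 1 ^ j))"
    by (simp only: q(3) const.eval_zero const_T.eval_zero)
  also have "\<dots> = ?h (\<Sum>j\<le>d. q j * var 1 ^ j)"
    using F by (simp add: const.eval_sum const.eval_mult const.eval_power inv)
  also have "\<dots> = (\<Sum>j\<le>d. [:q j:] * [:0, 1:] ^ j)"
    using q(2) by (simp add: const_T.eval_sum const_T.eval_mult const_T.eval_power h)
  finally have "q j = 0" if "j \<le> d" for j
    using nonconstant_is_transcendental[of "[:0, 1:]" q d j] that by simp
  then show False using q(1) by blast
qed

section \<open>Homomorphisms into a polynomial ring in one more variable\<close>

abbreviation eval_T :: "('v \<Rightarrow> ('u, 'k::comm_ring_1) mpol poly) \<Rightarrow> ('v, 'k) mpol \<Rightarrow> ('u, 'k) mpol poly" where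
  "eval_T \<equiv> eval (\<lambda>r. [:const_poly r:])"

lemma coeff_0_eval_T: "coeff (eval_T P p) 0 = eval const_poly (\<lambda>i. coeff (P i) 0) p"
  by (subst const_T.hom_eval[where h = "\<lambda>x. coeff x 0"]) (simp_all add: coeff_mult_0)

lemma poly_eval_T: "poly (eval_T P p) x = eval const_poly (\<lambda>i. poly (P i) x) p"
  by (subst const_T.hom_eval[where h = "\<lambda>y. poly y x"]) simp_all

section \<open>A coordinate is fixed by a shift\<close>

text \<open>Expressing \<open>x\<^sub>i\<close> as \<open>G\<^sub>i(F)\<close>, the homomorphism sends \<open>x\<^sub>i\<close> to \<open>P\<^sub>i = G\<^sub>i(F\<^sub>0,\<dots>,F\<^sub>j + T,\<dots>)\<close>.
  Algebraic independence of the \<open>F\<^sub>i\<close> gives \<open>f(G) = y\<^sub>0\<close>, so \<open>f\<close> goes to \<open>F\<^sub>0 = f\<close>. The index \<open>j\<close>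
  is one that occurs in some \<open>G\<^sub>i\<close> with \<open>i < n\<close>.\<close>

lemma coordinate_fixed_by_nontrivial_shift:
  fixes f :: "(nat, 'k::idom) mpol"
  assumes "stable_coordinate n f" "n \<ge> 2"
  shows "f \<noteq> 0 \<and> (\<exists>P. (\<forall>i<n. coeff (P i) 0 = var i) \<and> (\<exists>i<n. degree (P i) > 0) \<and> eval_T P f = [:f:])"
proof -
  obtain m F where f: "f \<in> poly_ring n" and mn: "m \<ge> n" and F: "F 0 = f"
      "gen_algebra (F ` {..<m}) = poly_ring m"
    using assms(1) unfolding stable_coordinate_def coordinate_def by blast
  have "\<exists>P\<in>poly_ring m. eval const_poly F P = var i" if "i < m" for i
    using gen_algebra_eq_eval[of "var i" F m] var_in_poly_ring[OF that] F(2) by force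
  then obtain G where G: "\<And>i. i < m \<Longrightarrow> G i \<in> poly_ring m" "\<And>i. i < m \<Longrightarrow> eval const_poly F (G i) = var i"
    by metis
  have indep: "P = 0" if "P \<in> poly_ring m" "eval const_poly F P = 0" for P
    using generators_independent[of m G F P] G that by blast
  have fm: "f \<in> poly_ring m"
    using f mn by (auto simp: poly_ring_def)
  note closed = subalgebra_poly_ring[of m, unfolded is_subalgebra_def]
  have diff: "x - y \<in> poly_ring m" if "x \<in> poly_ring m" "y \<in> poly_ring m" for x y :: "(nat, 'k) mpol"
  proof -
    have "const_poly (- 1) * y \<in> poly_ring m" using closed that by blast
    moreover have "const_poly (- 1) * y = - y"
      by (simp add: const_poly_def single_uminus)
    ultimately show ?thesis using closed that by (metis diff_conv_add_uminus)
  qed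
  have inj: "x = y" if "x \<in> poly_ring m" "y \<in> poly_ring m" "eval const_poly F x = eval const_poly F y" for x y
    using indep[OF diff[OF that(1,2)]] that(3) by (simp add: const.eval_diff)
  have Gf: "eval const_poly G f = var 0"
  proof (rule inj)
    show "eval const_poly G f \<in> poly_ring m"
      using G(1) fm by (intro eval_in_subalgebra subalgebra_poly_ring) (auto simp: poly_ring_def)
    show "(var 0 :: (nat, 'k) mpol) \<in> poly_ring m"
      using mn assms(2) by (intro var_in_poly_ring) simp
    show "eval const_poly F (eval const_poly G f) = eval const_poly F (var 0)"
      using eval_inverse[OF G(2) fm] F(1) by simp
  qed
  have "lookup (var 0 :: (nat, 'k) mpol) (single 0 1) = 1"
    unfolding var_def by (rule lookup_single_eq)
  then have "(var 0 :: (nat, 'k) mpol) \<noteq> 0"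
    by auto
  then have "f \<noteq> 0"
    using Gf by auto
  have "\<exists>i<n. \<exists>j\<in>poly_vars (G i). j \<noteq> 0"
  proof (rule ccontr)
    assume "\<not> ?thesis"
    then have "G i \<in> poly_ring 1" if "i < n" for i
      using that unfolding poly_ring_def by auto
    from this[of 0] this[of 1] assms(2) show False
      using no_two_variables_in_one_generator[of G F] G(2)[of 0] G(2)[of 1] mn assms(2) by simp
  qed
  then obtain i j where ij: "i < n" "j \<in> poly_vars (G i)" "j \<noteq> 0" by blast
  define V where "V u = (if u = j then [:F u, 1:] else [:F u:])" for u
  define P where "P i = eval_T V (G i)" for i
  have "coeff (P i) 0 = var i" if "i < n" for i
  proof -
    have "(\<lambda>u. coeff (V u) 0) = F" by (simp add: fun_eq_iff V_def)
    then show ?thesis using G(2) that mn by (simp add: P_def coeff_0_eval_T)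
  qed
  moreover have "eval_T P f = [:f:]"
  proof -
    have "eval_T P f = eval_T V (eval const_poly G f)"
      unfolding P_def by (subst const.hom_eval) (simp_all add: const_T.eval_add const_T.eval_mult)
    then show ?thesis using ij F(1) by (simp add: Gf V_def)
  qed
  moreover have "degree (P i) > 0"
  proof (rule ccontr)
    assume "\<not> degree (P i) > 0"
    then obtain c where c: "P i = [:c:]" by (metis degree_eq_zeroE gr0I)
    \<comment> \<open>If \<open>P\<^sub>i\<close> were constant in \<open>T\<close>, its values at \<open>T = 0\<close> and \<open>T = - F\<^sub>j\<close> would agree. The second
      is \<open>G\<^sub>i\<close> with \<open>y\<^sub>j\<close> set to zero, evaluated at \<open>F\<close>, so \<open>G\<^sub>i\<close> would not contain \<open>y\<^sub>j\<close>.\<close>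
    define Z where "Z = eval const_poly (\<lambda>u. if u = j then 0 else var u) (G i)"
    have Gi: "G i \<in> poly_ring m" using G(1) ij mn by simp
    have "Z \<in> {p. poly_vars p \<subseteq> {..<m} - {j}}"
      unfolding Z_def using Gi
      by (intro eval_in_subalgebra subalgebra_poly_vars) (auto simp: poly_vars_def var_def poly_ring_def)
    then have Z: "Z \<in> poly_ring m" "j \<notin> poly_vars Z"
      by (auto simp: poly_ring_def)
    have "eval const_poly F Z = eval const_poly (\<lambda>u. poly (V u) (- F j)) (G i)"
      unfolding Z_def
      by (subst const.hom_eval) (auto simp: const.eval_add const.eval_mult V_def if_distrib intro!: const.eval_cong)
    also have "\<dots> = poly (P i) (- F j)"
      by (simp add: P_def poly_eval_T)
    also have "\<dots> = poly (P i) 0"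
      by (simp add: c)
    also have "\<dots> = eval const_poly F (G i)"
      by (auto simp: P_def poly_eval_T V_def if_distrib intro!: const.eval_cong)
    finally have "Z = G i" by (rule inj[OF Z(1) Gi])
    with Z(2) ij show False by simp
  qed
  ultimately show ?thesis
    using ij \<open>f \<noteq> 0\<close> by blast
qed

section \<open>Natural multiples in an ordered group and weights\<close>

text \<open>Kept as an iterated sum, this agrees literally with the multiples in the weight of a monomial.\<close>

definition mul :: "nat \<Rightarrow> 'g::linordered_ab_group_add \<Rightarrow> 'g" where
  "mul N x = (\<Sum>_<N. x)"

lemma mul_simps [simp]: "mul 0 x = 0" "mul (Suc N) x = x + mul N x" "mul N 0 = 0"
  by (simp_all add: mul_def add.commute)

lemma mul_add_left: "mul (M + N) x = mul M x + mul N x"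
  by (induction M) (simp_all add: add.assoc)

lemma mul_add_right: "mul N (x + y) = mul N x + mul N y"
  by (simp add: mul_def sum.distrib)

lemma mul_diff: "mul N (x - y) = mul N x - mul N y"
  by (simp add: mul_def sum_subtractf)

lemma mul_sum: "mul N (\<Sum>i\<in>I. x i) = (\<Sum>i\<in>I. mul N (x i))"
  unfolding mul_def by (rule sum.swap)

lemma mul_mult: "mul (M * N) x = mul M (mul N x)"
  by (induction M) (simp_all add: mul_add_left)

lemma mul_commute: "mul M (mul N x) = mul N (mul M x)"
  by (metis mul_mult mult.commute)

lemma mul_mono: "x \<le> y \<Longrightarrow> mul N x \<le> mul N y"
  unfolding mul_def by (rule sum_mono)

lemma mul_strict_mono: "x < y \<Longrightarrow> N \<ge> 1 \<Longrightarrow> mul N x < mul N y"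
  unfolding mul_def by (rule sum_strict_mono) (auto simp: lessThan_empty_iff)

text \<open>The fraction \<open>\<tau> / N\<close> is the minimum of the slopes \<open>e / j\<close>. It need not exist in the group, so
  denominators are cleared by \<open>N\<close>; scaling all weights by \<open>N\<close> does not change initial forms.\<close>

lemma exists_minimal_slope:
  fixes X :: "(nat \<times> 'g::linordered_ab_group_add) set"
  assumes "finite X" "X \<noteq> {}" "\<And>j e. (j, e) \<in> X \<Longrightarrow> j \<ge> 1"
  shows "\<exists>N\<ge>1. \<exists>\<tau>. (\<forall>(j, e)\<in>X. mul j \<tau> \<le> mul N e) \<and> (\<exists>(j, e)\<in>X. mul j \<tau> = mul N e)"
  using assms
proof (induction rule: finite_ne_induct)
  case (singleton x)
  obtain j e where x: "x = (j, e)" by fastforce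
  with singleton have "j \<ge> 1" by auto
  then show ?case by (intro exI[of _ j] conjI exI[of _ e]) (auto simp: x)
next
  case (insert x X)
  obtain j e where x: "x = (j, e)" by fastforce
  with insert.prems have j: "j \<ge> 1" by auto
  obtain N \<tau> where N: "N \<ge> 1" "\<forall>(i, d)\<in>X. mul i \<tau> \<le> mul N d" "\<exists>(i, d)\<in>X. mul i \<tau> = mul N d"
    using insert.IH insert.prems by blast
  show ?case
  proof (cases "mul j \<tau> \<le> mul N e")
    case True
    with N show ?thesis by (intro exI[of _ N] conjI exI[of _ \<tau>]) (auto simp: x)
  next
    case False
    \<comment> \<open>The new element has slope \<open>e / j\<close> below \<open>\<tau> / N\<close>, so \<open>N e / (N j)\<close> replaces \<open>\<tau> / N\<close>.\<close>
    have "mul i (mul N e) \<le> mul (N * j) d" if "(i, d) \<in> X" for i d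
    proof -
      have "mul i (mul N e) \<le> mul i (mul j \<tau>)"
        using False by (intro mul_mono) simp
      also have "\<dots> = mul j (mul i \<tau>)"
        by (rule mul_commute)
      also have "\<dots> \<le> mul j (mul N d)"
        using N(2) that by (intro mul_mono) auto
      finally show ?thesis by (simp add: mul_mult mul_commute)
    qed
    moreover have "mul j (mul N e) = mul (N * j) e"
      by (simp add: mul_mult mul_commute)
    ultimately show ?thesis
      using N(1) j by (intro exI[of _ "N * j"] conjI exI[of _ "mul N e"]) (auto simp: x)
  qed
qed

lemma weight_eq: "weight n w a = (\<Sum>i<n. mul (lookup a i) (w i))"
  by (simp add: weight_def mul_def)

lemma weight_add:
  fixes w :: "nat \<Rightarrow> 'g::linordered_ab_group_add"
  shows "weight n w (a + b) = weight n w a + weight n w b"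
  by (simp add: weight_eq lookup_add mul_add_left sum.distrib)

lemma weight_var:
  fixes w :: "nat \<Rightarrow> 'g::linordered_ab_group_add"
  shows "i < n \<Longrightarrow> weight n w (single i 1) = w i"
  unfolding weight_eq by (subst sum.remove[of _ i]) (auto simp: lookup_single when_def intro!: sum.neutral)

lemma initial_form_eq: "initial_form n w f = part {a. weight n w a = wdegree n w f} f"
  unfolding initial_form_def part_def by (rule sum.cong) auto

lemma initial_form_nonzero:
  assumes "f \<noteq> 0"
  shows "initial_form n w f \<noteq> 0"
proof -
  have "wdegree n w f \<in> weight n w ` keys f"
    unfolding wdegree_def using assms by (intro Max_in) auto
  then have "keys (initial_form n w f) \<noteq> {}"
    by (auto simp: initial_form_eq keys_part)
  then show ?thesis by auto
qed

section \<open>Leading parts in a graded polynomial ring\<close>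

text \<open>The monomial \<open>x\<^sup>a T\<^sup>j\<close> has weight \<open>\<omega> a j\<close>.\<close>

locale bigrading =
  fixes \<omega> :: "(nat \<Rightarrow>\<^sub>0 nat) \<Rightarrow> nat \<Rightarrow> 'g::linordered_ab_group_add"
  assumes \<omega>_add: "\<omega> (a + b) (i + j) = \<omega> a i + \<omega> b j"
begin

definition weights_in :: "'g set \<Rightarrow> (nat, 'k::comm_ring_1) mpol poly \<Rightarrow> bool" where
  "weights_in D p \<longleftrightarrow> (\<forall>j. \<forall>a\<in>keys (coeff p j). \<omega> a j \<in> D)"

text \<open>The zero polynomial is allowed as a leading part, when all weights lie below \<open>d\<close>. This makes the
  relation compatible with sums, where top parts may cancel, and with products without any
  assumption on zero divisors.\<close>

definition leading :: "'g \<Rightarrow> (nat, 'k::comm_ring_1) mpol poly \<Rightarrow> (nat, 'k) mpol poly \<Rightarrow> bool" where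
  "leading d p q \<longleftrightarrow> weights_in {d} q \<and> weights_in {..<d} (p - q)"

definition top_part :: "'g \<Rightarrow> (nat, 'k::comm_ring_1) mpol poly \<Rightarrow> (nat, 'k) mpol poly" where
  "top_part d p = (\<Sum>j\<le>degree p. monom (part {a. \<omega> a j = d} (coeff p j)) j)"

lemma \<omega>_zero: "\<omega> 0 0 = 0"
  using \<omega>_add[of 0 0 0 0] by simp

lemma weights_in_mono: "weights_in D p \<Longrightarrow> D \<subseteq> E \<Longrightarrow> weights_in E p"
  by (auto simp: weights_in_def)

lemma weights_in_zero: "weights_in D 0"
  by (simp add: weights_in_def)

lemma weights_in_add: "weights_in D p \<Longrightarrow> weights_in D q \<Longrightarrow> weights_in D (p + q)"
  unfolding weights_in_def coeff_add by (meson UnE keys_add subsetD)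

lemma weights_in_uminus: "weights_in D p \<Longrightarrow> weights_in D (- p)"
  by (simp add: weights_in_def in_keys_iff)

lemma weights_in_diff: "weights_in D p \<Longrightarrow> weights_in D q \<Longrightarrow> weights_in D (p - q)"
  using weights_in_add[OF _ weights_in_uminus, of D p q] by simp

lemma weights_in_mult:
  assumes "weights_in D p" "weights_in E q" "\<And>x y. x \<in> D \<Longrightarrow> y \<in> E \<Longrightarrow> x + y \<in> C"
  shows "weights_in C (p * q)"
  unfolding weights_in_def
proof (intro allI ballI)
  fix j a assume "a \<in> keys (coeff (p * q) j)"
  then obtain i where i: "i \<le> j" "a \<in> keys (coeff p i * coeff q (j - i))"
    using subsetD[OF keys_sum[of "\<lambda>i. coeff p i * coeff q (j - i)" "{..j}"], of a] by (auto simp: coeff_mult)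
  then obtain b c where bc: "a = b + c" "b \<in> keys (coeff p i)" "c \<in> keys (coeff q (j - i))"
    using keys_mult by blast
  with assms have "\<omega> b i + \<omega> c (j - i) \<in> C"
    by (auto simp: weights_in_def)
  then show "\<omega> a j \<in> C"
    using i(1) \<omega>_add[of b c i "j - i"] by (simp add: bc)
qed

lemma leading_below: "leading d p q \<Longrightarrow> weights_in {..d} p"
  using weights_in_add[OF weights_in_mono[of "{..<d}" "p - q" "{..d}"] weights_in_mono[of "{d}" q "{..d}"]]
  by (auto simp: leading_def subset_iff intro: less_imp_le)

lemma leading_unique:
  assumes "leading d p q" "leading d p q'"
  shows "q = q'"
proof -
  have "weights_in {d} (q - q')"
    using assms weights_in_diff unfolding leading_def by blast
  moreover have "weights_in {..<d} ((p - q') - (p - q))"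
    using assms weights_in_diff unfolding leading_def by blast
  ultimately have "keys (coeff (q - q') j) = {}" for j
    by (fastforce simp: weights_in_def)
  then have "q - q' = 0"
    by (intro poly_eqI) simp
  then show ?thesis by simp
qed

lemma leading_add:
  assumes "leading d p q" "leading d p' q'"
  shows "leading d (p + p') (q + q')"
proof -
  have "(p + p') - (q + q') = (p - q) + (p' - q')" by simp
  then show ?thesis
    using assms weights_in_add unfolding leading_def by metis
qed

lemma leading_sum:
  assumes "\<And>i. i \<in> I \<Longrightarrow> leading d (p i) (q i)"
  shows "leading d (\<Sum>i\<in>I. p i) (\<Sum>i\<in>I. q i)"
  using assms
proof (induction I rule: infinite_finite_induct)
  case (insert i I)
  then show ?case by (simp add: leading_add)
qed (simp_all add: leading_def weights_in_zero)

lemma leading_mult: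
  assumes "leading d p q" "leading e p' q'"
  shows "leading (d + e) (p * p') (q * q')"
proof -
  have "weights_in {..<d + e} ((p - q) * p')"
    using assms leading_below[OF assms(2)]
    by (intro weights_in_mult[of "{..<d}" _ "{..e}"]) (auto simp: leading_def intro: add_less_le_mono)
  moreover have "weights_in {..<d + e} (q * (p' - q'))"
    using assms by (intro weights_in_mult[of "{d}" _ "{..<e}"]) (auto simp: leading_def)
  ultimately have "weights_in {..<d + e} (p * p' - q * q')"
    using weights_in_add[of "{..<d + e}" "(p - q) * p'" "q * (p' - q')"] by (simp add: algebra_simps)
  moreover have "weights_in {d + e} (q * q')"
    using assms by (intro weights_in_mult[of "{d}" _ "{e}"]) (auto simp: leading_def)
  ultimately show ?thesis by (simp add: leading_def)
qed

lemma leading_const: "leading 0 [:const_poly r:] [:const_poly r:]"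
  by (simp add: leading_def weights_in_zero) (auto simp: weights_in_def coeff_pCons const_poly_def \<omega>_zero split: nat.splits if_splits)

lemma leading_one: "leading 0 1 1"
  using leading_const[of 1] by (simp add: const_poly_simps flip: one_pCons)

lemma leading_power: "leading d p q \<Longrightarrow> leading (mul e d) (p ^ e) (q ^ e)"
  by (induction e) (auto intro: leading_one leading_mult)

lemma leading_prod:
  assumes "\<And>i. i \<in> I \<Longrightarrow> leading (d i) (p i) (q i)"
  shows "leading (\<Sum>i\<in>I. d i) (\<Prod>i\<in>I. p i) (\<Prod>i\<in>I. q i)"
  using assms by (induction I rule: infinite_finite_induct) (auto intro: leading_one leading_mult)

lemma coeff_top_part: "coeff (top_part d p) j = part {a. \<omega> a j = d} (coeff p j)"
proof (cases "j \<le> degree p")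
  case True
  then show ?thesis by (simp add: top_part_def coeff_sum)
next
  case False
  then show ?thesis by (simp add: top_part_def coeff_sum coeff_eq_0 part_def)
qed

lemma leading_top_part:
  assumes "weights_in {..d} p"
  shows "leading d p (top_part d p)"
  unfolding leading_def
proof
  show "weights_in {d} (top_part d p)"
    by (simp add: weights_in_def coeff_top_part keys_part)
  show "weights_in {..<d} (p - top_part d p)"
    unfolding weights_in_def
  proof (intro allI ballI)
    fix j a assume a: "a \<in> keys (coeff (p - top_part d p) j)"
    then have "\<omega> a j \<noteq> d" "a \<in> keys (coeff p j)"
      by (auto simp: in_keys_iff coeff_top_part lookup_minus lookup_part split: if_split_asm)
    moreover from this(2) have "\<omega> a j \<le> d"
      using assms unfolding weights_in_def by blast
    ultimately show "\<omega> a j \<in> {..<d}" by simp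
  qed
qed

text \<open>Each monomial of \<open>f\<close> of maximal weight contributes the product of the leading parts of its
  factors; the other monomials stay strictly below the maximal weight.\<close>

lemma leading_eval_T:
  assumes P: "\<And>i. i < n \<Longrightarrow> leading (mul N (w i)) (P i) (Q i)"
    and f: "f \<in> poly_ring n" and N: "N \<ge> 1"
  shows "leading (mul N (wdegree n w f)) (eval_T P f) (eval_T Q (initial_form n w f))"
proof -
  let ?d = "wdegree n w f"
  let ?c = "\<lambda>r. [:const_poly r:]"
  have monomial: "leading (mul N (weight n w a)) (?c r * mon_eval P a) (?c r * mon_eval Q a)"
    if "a \<in> keys f" for a r
  proof -
    have "keys a \<subseteq> {..<n}"
      using f that by (auto simp: poly_ring_def poly_vars_def)
    then have eq: "mon_eval P a = (\<Prod>i<n. P i ^ lookup a i)" "mon_eval Q a = (\<Prod>i<n. Q i ^ lookup a i)"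
      by (simp_all add: mon_eval_superset)
    have "leading (\<Sum>i<n. mul (lookup a i) (mul N (w i))) (mon_eval P a) (mon_eval Q a)"
      unfolding eq by (intro leading_prod leading_power P) simp
    moreover have "(\<Sum>i<n. mul (lookup a i) (mul N (w i))) = mul N (weight n w a)"
      unfolding weight_eq mul_sum by (intro sum.cong refl mul_commute)
    ultimately show ?thesis
      using leading_mult[OF leading_const[of r], of "mul N (weight n w a)"] by simp
  qed
  have summand: "leading (mul N ?d) (?c (lookup f a) * mon_eval P a)
      (?c (lookup (initial_form n w f) a) * mon_eval Q a)" if a: "a \<in> keys f" for a
  proof (cases "weight n w a = ?d")
    case True
    with monomial[OF a] show ?thesis by (simp add: initial_form_eq lookup_part)
  next
    case False
    have "weight n w a \<le> ?d"
      unfolding wdegree_def using a by (intro Max_ge) auto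
    with False have "mul N (weight n w a) < mul N ?d"
      using N by (intro mul_strict_mono) auto
    then have "weights_in {..<mul N ?d} (?c (lookup f a) * mon_eval P a)"
      by (intro weights_in_mono[OF leading_below[OF monomial[OF a]]] subsetI)
        (simp only: atMost_iff lessThan_iff le_less_trans)
    with False show ?thesis
      by (simp add: initial_form_eq lookup_part leading_def const_poly_simps weights_in_zero)
  qed
  have "eval_T Q (initial_form n w f) = (\<Sum>a\<in>keys f. ?c (lookup (initial_form n w f) a) * mon_eval Q a)"
    by (rule const_T.eval_superset) (auto simp: initial_form_eq keys_part)
  then show ?thesis
    unfolding eval_def[of ?c P] by (simp only: leading_sum[OF summand])
qed

text \<open>Seen as a constant in \<open>T\<close>, the polynomial \<open>f\<close> has its initial form as leading part. When \<open>f\<close>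
  is fixed, uniqueness of leading parts equates this with the leading part of the image of \<open>f\<close>.\<close>

lemma leading_initial_form:
  assumes "\<And>a. \<omega> a 0 = mul N (weight n w a)" "N \<ge> 1"
  shows "leading (mul N (wdegree n w f)) [:f:] [:initial_form n w f:]"
proof -
  have "\<omega> a 0 < mul N (wdegree n w f)" if "a \<in> keys f" "weight n w a \<noteq> wdegree n w f" for a
  proof -
    have "weight n w a \<le> wdegree n w f"
      unfolding wdegree_def using that by (intro Max_ge) auto
    with that(2) show ?thesis
      unfolding assms(1) using assms(2) by (intro mul_strict_mono) auto
  qed
  moreover have "a \<in> keys f \<and> weight n w a \<noteq> wdegree n w f" if "a \<in> keys (f - initial_form n w f)" for a
    using that by (auto simp: in_keys_iff lookup_minus initial_form_eq lookup_part split: if_splits)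
  ultimately show ?thesis
    by (auto simp: leading_def weights_in_def coeff_pCons assms(1) initial_form_eq keys_part split: nat.splits)
qed

end

section \<open>Degeneration of the shift\<close>

text \<open>The monomial \<open>x\<^sup>a T\<^sup>j\<close> in the image of \<open>x\<^sub>i\<close> must not have larger weight than \<open>x\<^sub>i\<close>, which
  bounds \<open>j \<tau>\<close> by \<open>N\<close> times the difference of the weights of \<open>x\<^sub>i\<close> and \<open>x\<^sup>a\<close>. Taking \<open>\<tau>\<close> as large as
  possible makes equality hold for some \<open>j \<ge> 1\<close>, and that monomial survives in the leading part.\<close>

lemma degeneration:
  fixes P :: "nat \<Rightarrow> (nat, 'k::comm_ring_1) mpol poly" and w :: "nat \<Rightarrow> 'g::linordered_ab_group_add"
  assumes P0: "\<And>i. i < n \<Longrightarrow> coeff (P i) 0 = var i" and moves: "\<exists>i<n. degree (P i) > 0"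
    and f: "f \<in> poly_ring n" and fixed: "eval_T P f = [:f:]"
  shows "\<exists>Q. (\<forall>i<n. coeff (Q i) 0 = var i) \<and> (\<exists>i<n. degree (Q i) > 0) \<and>
    eval_T Q (initial_form n w f) = [:initial_form n w f:]"
proof -
  define Y where "Y = (SIGMA i:{..<n}. SIGMA j:{1..degree (P i)}. keys (coeff (P i) j))"
  define X where "X = (\<lambda>(i, j, a). (j, w i - weight n w a)) ` Y"
  obtain i0 where i0: "i0 < n" "degree (P i0) > 0" using moves by blast
  then have "coeff (P i0) (degree (P i0)) \<noteq> 0" by auto
  then obtain a0 where "a0 \<in> keys (coeff (P i0) (degree (P i0)))"
    by (auto simp flip: keys_eq_empty)
  with i0 have "(i0, degree (P i0), a0) \<in> Y" by (simp add: Y_def)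
  then have "X \<noteq> {}" by (auto simp: X_def)
  moreover have "finite X" by (simp add: X_def Y_def)
  moreover have "j \<ge> 1" if "(j, e) \<in> X" for j e
    using that by (auto simp: X_def Y_def)
  ultimately obtain N \<tau> where N: "N \<ge> 1" "\<forall>(j, e)\<in>X. mul j \<tau> \<le> mul N e" "\<exists>(j, e)\<in>X. mul j \<tau> = mul N e"
    using exists_minimal_slope[of X] by blast
  define \<omega> where "\<omega> a j = mul N (weight n w a) + mul j \<tau>" for a j
  interpret bigrading \<omega>
    by unfold_locales (simp add: \<omega>_def weight_add mul_add_left mul_add_right algebra_simps)
  define Q where "Q i = top_part (mul N (w i)) (P i)" for i
  have "\<omega> a j \<le> mul N (w i)" if "i < n" "a \<in> keys (coeff (P i) j)" for i j a
  proof (cases "j = 0")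
    case True
    with that have "a = single i 1" by (simp add: P0 var_def)
    with True that show ?thesis using weight_var[of i n w] by (simp add: \<omega>_def)
  next
    case False
    have "j \<le> degree (P i)"
      using that(2) by (intro le_degree) auto
    with that False have "(j, w i - weight n w a) \<in> X"
      unfolding X_def Y_def by (intro image_eqI[of _ _ "(i, j, a)"]) auto
    with N(2) have "mul j \<tau> \<le> mul N (w i - weight n w a)" by blast
    then show ?thesis by (simp add: \<omega>_def mul_diff algebra_simps)
  qed
  then have lead: "leading (mul N (w i)) (P i) (Q i)" if "i < n" for i
    unfolding Q_def using that by (intro leading_top_part) (auto simp: weights_in_def)
  have "leading (mul N (wdegree n w f)) [:f:] (eval_T Q (initial_form n w f))"
    using leading_eval_T[where w = w and P = P and Q = Q, OF _ f N(1)] lead fixed by simp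
  moreover have "leading (mul N (wdegree n w f)) [:f:] [:initial_form n w f:]"
    using N(1) by (intro leading_initial_form) (simp_all add: \<omega>_def)
  ultimately have "eval_T Q (initial_form n w f) = [:initial_form n w f:]"
    by (rule leading_unique)
  moreover have "coeff (Q i) 0 = var i" if "i < n" for i
  proof -
    have "\<omega> (single i 1) 0 = mul N (w i)"
      using that weight_var[of i n w] by (simp add: \<omega>_def)
    then show ?thesis
      unfolding Q_def coeff_top_part P0[OF that]
      by (intro poly_mapping_eqI) (auto simp: lookup_part var_def lookup_single when_def)
  qed
  moreover have "\<exists>i<n. degree (Q i) > 0"
  proof -
    obtain i j a where ija: "(i, j, a) \<in> Y" "mul j \<tau> = mul N (w i - weight n w a)"
      using N(3) unfolding X_def by auto
    then have "\<omega> a j = mul N (w i)"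
      by (simp add: \<omega>_def mul_diff)
    with ija(1) have "a \<in> keys (coeff (Q i) j)"
      by (auto simp: Q_def coeff_top_part keys_part Y_def)
    then have "j \<le> degree (Q i)"
      by (intro le_degree) auto
    with ija(1) show ?thesis by (auto simp: Y_def intro!: exI[of _ i])
  qed
  ultimately show ?thesis by blast
qed

section \<open>Fixed polynomials and transcendence degree\<close>

text \<open>Relations on a set of polynomials use these polynomials as names of variables; here they are
  indexed by an arbitrary type instead.\<close>

lemma alg_independent_image:
  fixes b :: "'i \<Rightarrow> ('v, 'k::comm_ring_1) mpol"
  assumes indep: "alg_independent (b ` I)" and inj: "inj_on b I"
    and p: "poly_vars p \<subseteq> I" "eval const_poly b p = 0"
  shows "p = 0"
proof -
  define p' where "p' = eval const_poly (\<lambda>i. var (b i) :: (('v, 'k) mpol, 'k) mpol) p"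
  have compose: "eval const_poly g p' = eval const_poly (\<lambda>i. g (b i)) p"
    for g :: "('v, 'k) mpol \<Rightarrow> ('u, 'k) mpol"
    unfolding p'_def by (subst const.hom_eval) (simp_all add: const.eval_add const.eval_mult)
  have "p' \<in> {q. poly_vars q \<subseteq> b ` I}"
    unfolding p'_def using p(1)
    by (intro eval_in_subalgebra subalgebra_poly_vars) (auto simp: poly_vars_def var_def)
  moreover have "poly_subst (\<lambda>x. x) p' = 0"
    using p(2) by (simp add: poly_subst_eq_eval compose)
  ultimately have "p' = 0"
    using indep by (auto simp: alg_independent_def)
  then have "eval const_poly (\<lambda>i. var (the_inv_into I b (b i))) p = 0"
    using compose[of "\<lambda>x. var (the_inv_into I b x)"] by simp
  then show ?thesis
    using p(1) by (subst (asm) eval_fixes) (auto simp: the_inv_into_f_f[OF inj])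
qed

lemma trans_deg_attained:
  assumes "trans_deg A = enat n" "n > 0"
  shows "\<exists>B\<subseteq>A. finite B \<and> card B = n \<and> alg_independent B"
proof -
  let ?C = "{enat (card B) | B. B \<subseteq> A \<and> finite B \<and> alg_independent B}"
  have "enat (n - 1) < Sup ?C"
    using assms by (simp add: trans_deg_def)
  then obtain B where B: "B \<subseteq> A" "finite B" "alg_independent B" "n - 1 < card B"
    unfolding less_Sup_iff by auto
  then have "enat (card B) \<le> Sup ?C"
    by (intro Sup_upper) blast
  then have "card B \<le> n"
    using assms by (simp add: trans_deg_def)
  with B assms(2) show ?thesis by (intro exI[of _ B]) auto
qed

text \<open>The \<open>n\<close> independent fixed polynomials and a moved variable \<open>x\<^sub>i\<close> are algebraically dependent. The
  homomorphism turns their relation into one in which the coefficients are unchanged and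
  \<open>x\<^sub>i\<close> is replaced by a nonconstant polynomial in \<open>T\<close>, so all coefficients vanish.\<close>

lemma fixed_polynomials_not_full:
  fixes Q :: "nat \<Rightarrow> (nat, 'k::idom) mpol poly"
  assumes i: "i < n" "degree (Q i) > 0"
    and B: "B \<subseteq> poly_ring n" "finite B" "card B = n" "alg_independent B"
    and fixed: "\<And>b. b \<in> B \<Longrightarrow> eval_T Q b = [:b:]"
  shows False
proof -
  obtain b where b: "bij_betw b {..<n} B"
    using ex_bij_betw_nat_finite[OF B(2)] B(3) by (auto simp: atLeast0LessThan)
  then have bB: "b u \<in> B" if "u < n" for u
    using that by (auto simp: bij_betw_def)
  have indep: "p = 0" if "p \<in> poly_ring n" "eval const_poly b p = 0" for p
    using alg_independent_image[of b "{..<n}" p] b B(4) that by (auto simp: bij_betw_def poly_ring_def)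
  obtain q d where q: "\<exists>j\<le>d. q j \<noteq> 0" "\<forall>j. q j \<in> poly_ring n"
      "(\<Sum>j\<le>d. eval const_poly b (q j) * var i ^ j) = 0"
    using exists_algebraic_relation[of n b "var i", OF subsetD[OF B(1) bB] var_in_poly_ring[OF i(1)]]
    by blast
  have q_fixed: "eval_T Q (eval const_poly b (q j)) = [:eval const_poly b (q j):]" for j
  proof -
    have "eval_T Q (eval const_poly b (q j)) = eval_T (\<lambda>u. eval_T Q (b u)) (q j)"
      by (subst const.hom_eval) (simp_all add: const_T.eval_add const_T.eval_mult)
    also have "\<dots> = eval_T (\<lambda>u. [:b u:]) (q j)"
      using q(2) bB fixed by (intro const_T.eval_cong) (auto simp: poly_ring_def)
    also have "\<dots> = [:eval const_poly b (q j):]"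
      by (subst const.hom_eval[where h = "\<lambda>x. [:x:]"]) (simp_all add: one_pCons mult.commute)
    finally show ?thesis .
  qed
  have "0 = eval_T Q (\<Sum>j\<le>d. eval const_poly b (q j) * var i ^ j)"
    by (simp only: q(3) const_T.eval_zero)
  also have "\<dots> = (\<Sum>j\<le>d. [:eval const_poly b (q j):] * Q i ^ j)"
    by (simp add: const_T.eval_sum const_T.eval_mult const_T.eval_power q_fixed)
  finally have "eval const_poly b (q j) = 0" if "j \<le> d" for j
    using that by (intro nonconstant_is_transcendental[OF i(2)]) simp_all
  with q indep show False by blast
qed

section \<open>Divisors of the initial form of a stable coordinate\<close>

theorem corollary1p5:
  fixes n :: nat
    and f :: "(nat, 'k::idom) mpol"
    and S :: "(nat, 'k) mpol set"
    and w :: "nat \<Rightarrow> 'g::linordered_ab_group_add"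
  assumes "n \<ge> 2"
    and "stable_coordinate n f"
    and "S \<subseteq> poly_ring n - {0}"
    and "trans_deg (gen_algebra S) = enat n"
  shows "\<exists>g\<in>S. \<not> (\<exists>h\<in>poly_ring n. initial_form n w f = g * h)"
proof (rule ccontr)
  let ?f = "initial_form n w f"
  assume "\<not> ?thesis"
  then have divides: "\<exists>h. ?f = g * h" if "g \<in> S" for g
    using that by blast
  obtain P where P: "f \<noteq> 0" "\<forall>i<n. coeff (P i) 0 = var i" "\<exists>i<n. degree (P i) > 0" "eval_T P f = [:f:]"
    using coordinate_fixed_by_nontrivial_shift[OF assms(2,1)] by blast
  have "f \<in> poly_ring n"
    using assms(2) by (simp add: stable_coordinate_def)
  then obtain Q i where Q: "\<forall>i<n. coeff (Q i) 0 = var i" "i < n" "degree (Q i) > 0" "eval_T Q ?f = [:?f:]"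
    using degeneration[of n P f w] P by blast
  define A where "A = {p \<in> poly_ring n. eval_T Q p = [:p:]}"
  have "is_subalgebra A"
    using subalgebra_poly_ring[of n, where ?'k = 'k] unfolding is_subalgebra_def A_def
    by (auto simp: const_T.eval_add const_T.eval_mult mult.commute)
  moreover have "S \<subseteq> A"
  proof
    fix g assume "g \<in> S"
    then have g: "g \<in> poly_ring n" using assms(3) by blast
    obtain h where h: "?f = g * h" using divides \<open>g \<in> S\<close> by blast
    have prod: "eval_T Q g * eval_T Q h = [:?f:]"
      using Q(4) by (simp add: h const_T.eval_mult)
    moreover have "[:?f:] \<noteq> 0"
      using initial_form_nonzero[OF P(1)] by simp
    ultimately have "degree (eval_T Q g) + degree (eval_T Q h) = 0"
      by (metis degree_mult_eq degree_pCons_0 mult_zero_left mult_zero_right)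
    then obtain c where c: "eval_T Q g = [:c:]"
      by (metis add_is_0 degree_eq_zeroE)
    \<comment> \<open>At \<open>T = 0\<close> the homomorphism is the inclusion.\<close>
    have "c = coeff (eval_T Q g) 0" by (simp add: c)
    also have "\<dots> = g"
      unfolding coeff_0_eval_T using Q(1) g by (intro eval_fixes) (auto simp: poly_ring_def)
    finally show "g \<in> A" using g c by (simp add: A_def)
  qed
  ultimately have "gen_algebra S \<subseteq> A" by (rule gen_algebra_least)
  obtain B where B: "B \<subseteq> gen_algebra S" "finite B" "card B = n" "alg_independent B"
    using trans_deg_attained[OF assms(4)] assms(1) by auto
  have "B \<subseteq> A"
    using B(1) \<open>gen_algebra S \<subseteq> A\<close> by (rule subset_trans)
  show False
    by (rule fixed_polynomials_not_full[of i n Q B]) (use B(2-4) Q(2,3) \<open>B \<subseteq> A\<close> in \<open>auto simp: A_def\<close>)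
qed

end
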